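(* Let $I$ be an interval of $\mathbb{R}$ of positive length (possibly unbounded, possibly $\mathbb{R}$ itself). Then there exists an uncountable Golomb ruler $S\subseteq I$, and $S$ may moreover be chosen to be dense in $I$.
   Context: A subset $S$ of an additive group (here $\mathbb{R}$) is a Golomb ruler (Sidon set) if for all $x_1,x_2,x_3,x_4\in S$, $x_1+x_2=x_3+x_4$ holds if and only if $\{x_1,x_2\}=\{x_3,x_4\}$. *)

theory Defs
  imports "HOL-Analysis.Analysis"
begin

definition golomb_ruler :: "'a::ab_group_add set \<Rightarrow> bool" where
  "golomb_ruler S \<longleftrightarrow>
     (\<forall>x1\<in>S. \<forall>x2\<in>S. \<forall>x3\<in>S. \<forall>x4\<in>S.
        x1 + x2 = x3 + x4 \<longleftrightarrow> {x1, x2} = {x3, x4})"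

end

theory Submission
  imports Defs
begin

text \<open>If \<open>S\<close> is a countable Golomb ruler, then adjoining \<open>x\<close> can only fail when \<open>x = b + c - a\<close> or
  \<open>2 x = a + b\<close> for some \<open>a, b, c \<in> S\<close>, which excludes only countably many \<open>x\<close>. Hence points
  can be chosen one at a time from the uncountable traces on \<open>I\<close> of a countable basis, giving a dense
  Golomb ruler in \<open>I\<close>; by Zorn's lemma it lies in a maximal one, and a maximal one cannot be
  countable.\<close>

lemma golomb_rulerI:
  assumes "\<And>x1 x2 x3 x4. \<lbrakk>x1 \<in> S; x2 \<in> S; x3 \<in> S; x4 \<in> S; x1 + x2 = x3 + x4\<rbrakk>
             \<Longrightarrow> {x1, x2} = {x3, x4}"
  shows "golomb_ruler S"
  unfolding golomb_ruler_def using assms by (auto simp: doubleton_eq_iff add.commute)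

lemma golomb_rulerD:
  assumes "golomb_ruler S" "x1 \<in> S" "x2 \<in> S" "x3 \<in> S" "x4 \<in> S" "x1 + x2 = x3 + x4"
  shows "x1 = x3 \<and> x2 = x4 \<or> x1 = x4 \<and> x2 = x3"
  using assms unfolding golomb_ruler_def by (metis doubleton_eq_iff)

lemma golomb_ruler_empty [simp]: "golomb_ruler {}"
  by (simp add: golomb_ruler_def)

text \<open>A violation of the ruler condition involves only four points, and finitely many points
  of the union of a nonempty chain already lie in one member.\<close>

lemma golomb_ruler_Union_chain:
  assumes "subset.chain \<A> \<C>" "\<And>S. S \<in> \<C> \<Longrightarrow> golomb_ruler S"
  shows "golomb_ruler (\<Union>\<C>)"
proof (cases "\<C> = {}")
  case False
  show ?thesis
  proof (rule golomb_rulerI)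
    fix x1 x2 x3 x4
    assume x: "x1 \<in> \<Union>\<C>" "x2 \<in> \<Union>\<C>" "x3 \<in> \<Union>\<C>" "x4 \<in> \<Union>\<C>" and eq: "x1 + x2 = x3 + x4"
    obtain S where "S \<in> \<C>" "{x1, x2, x3, x4} \<subseteq> S"
      using finite_subset_Union_chain[of "{x1, x2, x3, x4}" \<C> \<A>] x False assms(1) by auto
    then show "{x1, x2} = {x3, x4}"
      using assms(2) eq golomb_rulerD[of S x1 x2 x3 x4] by auto
  qed
qed simp

lemma golomb_ruler_insert:
  fixes S :: "real set"
  assumes S: "golomb_ruler S"
    and sum: "\<And>a b c. \<lbrakk>a \<in> S; b \<in> S; c \<in> S\<rbrakk> \<Longrightarrow> x \<noteq> b + c - a"
    and mid: "\<And>a b. \<lbrakk>a \<in> S; b \<in> S\<rbrakk> \<Longrightarrow> x \<noteq> (a + b) / 2"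
  shows "golomb_ruler (insert x S)"
proof (rule golomb_rulerI)
  fix x1 x2 x3 x4
  assume x: "x1 \<in> insert x S" "x2 \<in> insert x S" "x3 \<in> insert x S" "x4 \<in> insert x S"
    and eq: "x1 + x2 = x3 + x4"
  have sum': "x + a \<noteq> b + c" if "a \<in> S" "b \<in> S" "c \<in> S" for a b c
    using sum[OF that] by auto
  have mid': "x + x \<noteq> a + b" if "a \<in> S" "b \<in> S" for a b
    using mid[OF that] by auto
  show "{x1, x2} = {x3, x4}"
  \<comment> \<open>A term common to both sides cancels and leaves the other two terms equal.
    Otherwise \<open>x\<close> occurs on at most one side: once contradicts \<open>sum'\<close>,
    twice contradicts \<open>mid'\<close>, and not at all is the case of \<open>S\<close>
    itself.\<close>
  proof (cases "x1 = x3 \<or> x1 = x4 \<or> x2 = x3 \<or> x2 = x4")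
    case True
    then show ?thesis
      using eq by auto
  next
    case False
    then show ?thesis
      using x eq sum'[of x2 x3 x4] sum'[of x1 x3 x4] sum'[of x4 x1 x2] sum'[of x3 x1 x2]
        mid'[of x3 x4] mid'[of x1 x2] golomb_rulerD[OF S, of x1 x2 x3 x4]
      by (elim insertE) (simp_all add: add.commute)
  qed
qed

lemma golomb_ruler_extend:
  fixes S A :: "real set"
  assumes "golomb_ruler S" "countable S" "uncountable A"
  obtains x where "x \<in> A - S" "golomb_ruler (insert x S)"
proof -
  \<comment> \<open>Excluding \<open>S\<close> as well makes the extension proper, as the
    contradiction with maximality will require.\<close>
  let ?B = "S \<union> (\<lambda>(a, b, c). b + c - a) ` (S \<times> S \<times> S) \<union> (\<lambda>(a, b). (a + b) / 2) ` (S \<times> S)"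
  have "countable ?B"
    using assms(2) by (intro countable_Un countable_image countable_SIGMA)
  then obtain x where x: "x \<in> A" "x \<notin> ?B"
    using assms(3) by (meson countable_subset subsetI)
  have "golomb_ruler (insert x S)"
    using x(2) by (intro golomb_ruler_insert assms(1)) force+
  then show thesis
    using x that by blast
qed

lemma golomb_ruler_meeting_uncountable_sets:
  fixes U :: "nat \<Rightarrow> real set"
  assumes "\<And>n. uncountable (U n)"
  obtains D where "golomb_ruler D" "D \<subseteq> (\<Union>n. U n)" "\<And>n. D \<inter> U n \<noteq> {}"
proof -
  \<comment> \<open>Finiteness keeps every stage countable, so that a further point can be adjoined;
    stage \<open>n\<close> takes this point from \<open>U n\<close>.\<close>
  let ?P = "\<lambda>n F. finite F \<and> golomb_ruler F \<and> F \<subseteq> (\<Union>n. U n)"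
  let ?Q = "\<lambda>n F F'. F \<subseteq> F' \<and> F' \<inter> U n \<noteq> {}"
  have step: "\<exists>F'. ?P (Suc n) F' \<and> ?Q n F F'" if F: "?P n F" for n F
  proof -
    obtain x where "x \<in> U n - F" "golomb_ruler (insert x F)"
      using golomb_ruler_extend[of F "U n"] F assms[of n] uncountable_infinite countable_finite by metis
    then show ?thesis
      using F by (intro exI[of _ "insert x F"]) auto
  qed
  have "?P 0 {}"
    by simp
  then obtain F where F: "\<And>n. ?P n (F n)" "\<And>n. ?Q n (F n) (F (Suc n))"
    using dependent_nat_choice[of ?P ?Q] step by metis
  have "incseq F"
    using F(2) by (intro incseq_SucI) auto
  then have "subset.chain UNIV (range F)"
    unfolding subset_chain_def by (auto simp: incseq_def) (meson nat_le_linear subsetD)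
  then have "golomb_ruler (\<Union>n. F n)"
    using F(1) by (intro golomb_ruler_Union_chain) auto
  moreover have "(\<Union>n. F n) \<subseteq> (\<Union>n. U n)"
    using F(1) by (intro UN_least) simp
  moreover have "(\<Union>n. F n) \<inter> U n \<noteq> {}" for n
    using F(2)[of n] by blast
  ultimately show thesis
    using that by blast
qed

text \<open>A connected set of reals with two distinct points is uncountable. A ball inside
  \<open>V\<close> has a connected trace on \<open>I\<close> because both are convex, and this trace
  has a second point because \<open>x\<close>, even as an endpoint, is a limit point of
  \<open>I\<close>.\<close>

lemma uncountable_open_Int_interval:
  fixes I :: "real set"
  assumes "is_interval I" "a \<in> I" "b \<in> I" "a < b" "x \<in> I" "open V" "x \<in> V"
  shows "uncountable (V \<inter> I)"
proof -
  obtain e where e: "e > 0" "ball x e \<subseteq> V"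
    using assms openE by blast
  have "x islimpt I"
    using assms by (intro connected_imp_perfect is_interval_connected) auto
  then obtain y where y: "y \<in> I" "y \<in> ball x e" "y \<noteq> x"
    using e(1) unfolding islimpt_def by (metis centre_in_ball open_ball)
  have "connected (ball x e \<inter> I)"
    using assms(1) by (intro convex_connected convex_Int convex_ball is_interval_convex)
  then have "uncountable (ball x e \<inter> I)"
    using connected_uncountable[of "ball x e \<inter> I" x y] y e(1) assms(5) by auto
  then show ?thesis
    using e(2) by (meson Int_mono countable_subset order_refl)
qed

lemma golomb_ruler_dense_in_interval:
  fixes I :: "real set"
  assumes I: "is_interval I" "a \<in> I" "b \<in> I" "a < b"
  obtains D where "golomb_ruler D" "D \<subseteq> I" "I \<subseteq> closure D"
proof -
  obtain B :: "real set set" where B: "countable B" "topological_basis B"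
    using ex_countable_basis by blast
  define C where "C = (\<lambda>V. V \<inter> I) ` {V \<in> B. V \<inter> I \<noteq> {}}"
  have unc: "uncountable W" if "W \<in> C" for W
    using that uncountable_open_Int_interval[OF I] topological_basis_open[OF B(2)]
    unfolding C_def by blast
  have basic: "\<exists>W\<in>C. W \<subseteq> V" if x: "x \<in> I" "open V" "x \<in> V" for x V
  proof -
    obtain W where "W \<in> B" "x \<in> W" "W \<subseteq> V"
      using topological_basisE[OF B(2) x(2,3)] .
    then have "W \<inter> I \<in> C" "W \<inter> I \<subseteq> V"
      using x(1) unfolding C_def by blast+
    then show ?thesis ..
  qed
  have "countable C"
    using B(1) unfolding C_def by (intro countable_image) (rule countable_Collect)
  \<comment> \<open>Only for a nonempty countable set is the range of \<open>from_nat_into\<close>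
    the set itself.\<close>
  moreover have "C \<noteq> {}"
    using basic[OF I(2) open_UNIV] by blast
  ultimately have rng: "range (from_nat_into C) = C"
    by (simp add: range_from_nat_into)
  have "uncountable (from_nat_into C n)" for n
    using unc rng by blast
  then obtain D where D: "golomb_ruler D" "D \<subseteq> (\<Union>n. from_nat_into C n)"
      "\<And>n. D \<inter> from_nat_into C n \<noteq> {}"
    using golomb_ruler_meeting_uncountable_sets[of "from_nat_into C"] by metis
  have meets: "D \<inter> W \<noteq> {}" if "W \<in> C" for W
    using D(3) rng that by (metis (no_types, lifting) rangeE)
  have "D \<subseteq> I"
    using D(2) unfolding rng by (auto simp: C_def)
  moreover have "I \<subseteq> closure D"
  proof
    fix x assume "x \<in> I"
    then have "D \<inter> V \<noteq> {}" if "open V" "x \<in> V" for V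
      using basic[OF _ that] meets by blast
    \<comment> \<open>Were \<open>x\<close> outside the closure, its complement would be an open
      neighbourhood of \<open>x\<close> that misses \<open>D\<close>.\<close>
    from this[of "- closure D"] show "x \<in> closure D"
      using closure_subset[of D] by auto
  qed
  ultimately show thesis
    using that D(1) by blast
qed

lemma golomb_ruler_uncountable_superset:
  fixes A D :: "real set"
  assumes "golomb_ruler D" "D \<subseteq> A" "uncountable A"
  obtains S where "golomb_ruler S" "D \<subseteq> S" "S \<subseteq> A" "uncountable S"
proof -
  let ?\<A> = "{S. golomb_ruler S \<and> D \<subseteq> S \<and> S \<subseteq> A}"
  \<comment> \<open>A nonempty chain is required here: the empty union need not contain
    \<open>D\<close>.\<close>
  have "\<Union>\<C> \<in> ?\<A>" if "\<C> \<noteq> {}" "subset.chain ?\<A> \<C>" for \<C>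
  proof -
    have "\<C> \<subseteq> ?\<A>"
      using that(2) by (simp add: subset_chain_def)
    then show ?thesis
      using that golomb_ruler_Union_chain[OF that(2)] by blast
  qed
  moreover have "?\<A> \<noteq> {}"
    using assms by blast
  ultimately have "\<exists>M\<in>?\<A>. \<forall>X\<in>?\<A>. M \<subseteq> X \<longrightarrow> X = M"
    by (intro subset_Zorn_nonempty)
  then obtain M where M: "M \<in> ?\<A>" and max: "\<And>X. \<lbrakk>X \<in> ?\<A>; M \<subseteq> X\<rbrakk> \<Longrightarrow> X = M"
    by (elim bexE) simp
  have "uncountable M"
  proof
    assume "countable M"
    then obtain x where "x \<in> A - M" "golomb_ruler (insert x M)"
      using golomb_ruler_extend[of M A] M assms(3) by blast
    then show False
      using max[of "insert x M"] M by blast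
  qed
  then show thesis
    using M by (intro that[of M]) auto
qed

theorem theorem18:
  fixes I :: "real set"
  assumes "is_interval I"
    and "\<exists>a\<in>I. \<exists>b\<in>I. a < b"
  shows "\<exists>S. S \<subseteq> I \<and> golomb_ruler S \<and> uncountable S \<and> I \<subseteq> closure S"
proof -
  obtain a b where ab: "a \<in> I" "b \<in> I" "a < b"
    using assms(2) by blast
  obtain D where D: "golomb_ruler D" "D \<subseteq> I" "I \<subseteq> closure D"
    using golomb_ruler_dense_in_interval[OF assms(1) ab] .
  \<comment> \<open>The interval is its own trace on the open set \<open>UNIV\<close>.\<close>
  have "uncountable I"
    using uncountable_open_Int_interval[OF assms(1) ab ab(1) open_UNIV] by simp
  then obtain S where "golomb_ruler S" "D \<subseteq> S" "S \<subseteq> I" "uncountable S"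
    using golomb_ruler_uncountable_superset[OF D(1,2)] by blast
  then show ?thesis
    \<comment> \<open>Density passes from \<open>D\<close> to the larger set
      \<open>S\<close>.\<close>
    using D(3) closure_mono by blast
qed

end
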